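(* Let $H$ be the quaternion algebra over the field $\mathbb{R}$ of real numbers and let $a\in H$. Consider the equation $x^2=a$ in the unknown $x\in H$. (1) If $\operatorname{Re}\sqrt{a}\neq 0$ (that is, the equation $x^2=a$ has a root whose scalar part is nonzero), then the equation $x^2=a$ has roots $x=x_1$, $x=x_2$ such that $x_2=-x_1$. (2) If $a=0$, then the equation $x^2=a$ has the root $x=0$ with multiplicity $2$. (3) If neither the condition of (1) nor the condition of (2) holds (that is, $a\neq 0$ and no root of $x^2=a$ has nonzero scalar part), then the equation $x^2=a$ has infinitely many roots $x$, such that $$x\in \operatorname{Im} H,\qquad a\in \operatorname{Re} H,\qquad |x|=\sqrt{-a}.$$
   Context: $H$ is the algebra of elements $x=x^0+x^1 i+x^2 j+x^3 k$ with $x^0,x^1,x^2,x^3\in\mathbb{R}$ (superscripts are coordinate indices) and the usual multiplication $i^2=j^2=k^2=-1$, $ij=k=-ji$, $jk=i=-kj$, $ki=j=-ik$. In the equation $x^2=a$, $x^2$ means the product $xx$. The scalar part is $\operatorname{Re} x=x^0$ and the vector part is $\operatorname{Im} x=x-x^0$. $\operatorname{Re} H=\{x\in H:\operatorname{Re}x=x\}=\mathbb{R}$ and $\operatorname{Im} H=\{x\in H: \operatorname{Re} x=0\}$. The norm is given by $|x|^2=(x^0)^2+(x^1)^2+(x^2)^2+(x^3)^2$. A square root $\sqrt a$ of $a\in H$ means a root of the equation $x^2=a$. Multiplicity $2$ of the root $0$ in (2) refers to the factorization $x^2=(x-0)(x-0)$. *)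

theory Defs
  imports "HOL-Analysis.Inner_Product"
begin

text \<open>The quaternion \<open>x\<^sup>0 + x\<^sup>1 i + x\<^sup>2 j + x\<^sup>3 k\<close> is \<open>Quat x\<^sup>0 x\<^sup>1 x\<^sup>2 x\<^sup>3\<close>.\<close>

datatype quat = Quat (qRe: real) (qI: real) (qJ: real) (qK: real)

lemma quat_eqI: "qRe x = qRe y \<Longrightarrow> qI x = qI y \<Longrightarrow> qJ x = qJ y \<Longrightarrow> qK x = qK y \<Longrightarrow> x = y"
  by (cases x; cases y) simp

lemma quat_eq_iff: "x = y \<longleftrightarrow> qRe x = qRe y \<and> qI x = qI y \<and> qJ x = qJ y \<and> qK x = qK y"
  by (auto intro: quat_eqI)

instantiation quat :: ring_1
begin

definition "0 = Quat 0 0 0 0"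
definition "1 = Quat 1 0 0 0"
definition "x + y = Quat (qRe x + qRe y) (qI x + qI y) (qJ x + qJ y) (qK x + qK y)"
definition "- x = Quat (- qRe x) (- qI x) (- qJ x) (- qK x)"
definition "x - y = Quat (qRe x - qRe y) (qI x - qI y) (qJ x - qJ y) (qK x - qK y)"
definition "x * y = Quat
   (qRe x * qRe y - qI x * qI y - qJ x * qJ y - qK x * qK y)
   (qRe x * qI y + qI x * qRe y + qJ x * qK y - qK x * qJ y)
   (qRe x * qJ y - qI x * qK y + qJ x * qRe y + qK x * qI y)
   (qRe x * qK y + qI x * qJ y - qJ x * qI y + qK x * qRe y)"

instance
  by standard
    (simp_all add: zero_quat_def one_quat_def plus_quat_def uminus_quat_def minus_quat_def
      times_quat_def algebra_simps)

end

lemma quat_zero_simps [simp]: "qRe 0 = 0" "qI 0 = 0" "qJ 0 = 0" "qK 0 = 0"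
  by (simp_all add: zero_quat_def)

lemma quat_one_simps [simp]: "qRe 1 = 1" "qI 1 = 0" "qJ 1 = 0" "qK 1 = 0"
  by (simp_all add: one_quat_def)

lemma quat_plus_simps [simp]:
  "qRe (x + y) = qRe x + qRe y" "qI (x + y) = qI x + qI y"
  "qJ (x + y) = qJ x + qJ y" "qK (x + y) = qK x + qK y"
  by (simp_all add: plus_quat_def)

lemma quat_uminus_simps [simp]:
  "qRe (- x) = - qRe x" "qI (- x) = - qI x" "qJ (- x) = - qJ x" "qK (- x) = - qK x"
  by (simp_all add: uminus_quat_def)

lemma quat_minus_simps [simp]:
  "qRe (x - y) = qRe x - qRe y" "qI (x - y) = qI x - qI y"
  "qJ (x - y) = qJ x - qJ y" "qK (x - y) = qK x - qK y"
  by (simp_all add: minus_quat_def)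

lemma quat_times_simps [simp]:
  "qRe (x * y) = qRe x * qRe y - qI x * qI y - qJ x * qJ y - qK x * qK y"
  "qI (x * y) = qRe x * qI y + qI x * qRe y + qJ x * qK y - qK x * qJ y"
  "qJ (x * y) = qRe x * qJ y - qI x * qK y + qJ x * qRe y + qK x * qI y"
  "qK (x * y) = qRe x * qK y + qI x * qJ y - qJ x * qI y + qK x * qRe y"
  by (simp_all add: times_quat_def)

instantiation quat :: real_algebra_1
begin

definition "r *\<^sub>R x = Quat (r * qRe x) (r * qI x) (r * qJ x) (r * qK x)"

instance
  by standard (simp_all add: scaleR_quat_def quat_eq_iff algebra_simps)

end

lemma quat_scaleR_simps [simp]:
  "qRe (r *\<^sub>R x) = r * qRe x" "qI (r *\<^sub>R x) = r * qI x"
  "qJ (r *\<^sub>R x) = r * qJ x" "qK (r *\<^sub>R x) = r * qK x"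
  by (simp_all add: scaleR_quat_def)

lemma quat_of_real_simps [simp]:
  "qRe (of_real r) = r" "qI (of_real r) = 0" "qJ (of_real r) = 0" "qK (of_real r) = 0"
  by (simp_all add: of_real_def)

instantiation quat :: real_inner
begin

definition "inner x y = qRe x * qRe y + qI x * qI y + qJ x * qJ y + qK x * qK y"
definition "norm x = sqrt ((qRe x)\<^sup>2 + (qI x)\<^sup>2 + (qJ x)\<^sup>2 + (qK x)\<^sup>2)"
definition "sgn x = x /\<^sub>R norm (x :: quat)"
definition "dist x y = norm (x - y :: quat)"
definition "uniformity = (INF e\<in>{0 <..}. principal {(x :: quat, y). dist x y < e})"
definition "open U = (\<forall>x\<in>U. eventually (\<lambda>(x', y). x' = x \<longrightarrow> y \<in> U) (uniformity :: (quat \<times> quat) filter))"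

instance
proof
  fix x y z :: quat and r :: real
  show "inner x y = inner y x" by (simp add: inner_quat_def mult.commute)
  show "inner (x + y) z = inner x z + inner y z" by (simp add: inner_quat_def algebra_simps)
  show "inner (r *\<^sub>R x) y = r * inner x y" by (simp add: inner_quat_def algebra_simps)
  show "0 \<le> inner x x" by (simp add: inner_quat_def)
  show "norm x = sqrt (inner x x)" by (simp add: inner_quat_def norm_quat_def power2_eq_square)
  have "a * a + b * b + c * c + d * d = 0 \<longleftrightarrow> a = 0 \<and> b = 0 \<and> c = 0 \<and> d = 0" for a b c d :: real
    by (smt (verit) mult_eq_0_iff not_real_square_gt_zero zero_le_square)
  then show "inner x x = 0 \<longleftrightarrow> x = 0" by (simp add: inner_quat_def quat_eq_iff)
qed (simp_all add: sgn_quat_def dist_quat_def uniformity_quat_def open_quat_def)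

end

instantiation quat :: real_normed_div_algebra
begin

definition "inverse x = Quat (qRe x) (- qI x) (- qJ x) (- qK x) /\<^sub>R (norm x)\<^sup>2"
definition "x div y = x * inverse (y :: quat)"

instance
proof
  fix x y :: quat
  show "norm (x * y) = norm x * norm y"
    unfolding norm_quat_def real_sqrt_mult [symmetric]
    by (rule arg_cong [where f = sqrt]) (simp add: power2_eq_square algebra_simps)
  have n: "(norm x)\<^sup>2 = (qRe x)\<^sup>2 + (qI x)\<^sup>2 + (qJ x)\<^sup>2 + (qK x)\<^sup>2"
    by (simp add: norm_quat_def)
  let ?c = "Quat (qRe x) (- qI x) (- qJ x) (- qK x)"
  have c: "x * ?c = (norm x)\<^sup>2 *\<^sub>R 1" "?c * x = (norm x)\<^sup>2 *\<^sub>R 1"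
    unfolding n by (simp_all add: quat_eq_iff power2_eq_square)
  show "x \<noteq> 0 \<Longrightarrow> inverse x * x = 1" "x \<noteq> 0 \<Longrightarrow> x * inverse x = 1"
    unfolding inverse_quat_def mult_scaleR_left mult_scaleR_right c by simp_all
qed (simp_all add: divide_quat_def inverse_quat_def quat_eq_iff)

end

definition quat_i :: quat where "quat_i = Quat 0 1 0 0"
definition quat_j :: quat where "quat_j = Quat 0 0 1 0"
definition quat_k :: quat where "quat_k = Quat 0 0 0 1"

lemma quat_expand:
  "x = of_real (qRe x) + of_real (qI x) * quat_i + of_real (qJ x) * quat_j + of_real (qK x) * quat_k"
  by (simp add: quat_eq_iff quat_i_def quat_j_def quat_k_def)

lemma quat_unit_table:
  "quat_i * quat_i = -1" "quat_j * quat_j = -1" "quat_k * quat_k = -1"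
  "quat_i * quat_j = quat_k" "quat_j * quat_i = - quat_k"
  "quat_j * quat_k = quat_i" "quat_k * quat_j = - quat_i"
  "quat_k * quat_i = quat_j" "quat_i * quat_k = - quat_j"
  by (simp_all add: quat_eq_iff quat_i_def quat_j_def quat_k_def)

definition Re_H :: "quat set"
  where "Re_H = {x. of_real (qRe x) = x}"

definition Im_H :: "quat set"
  where "Im_H = {x. qRe x = 0}"

definition square_roots :: "quat \<Rightarrow> quat set"
  where "square_roots a = {x. x * x = a}"

text \<open>
  A root \<open>r\<close> of a monic polynomial \<open>f\<close> in a noncommuting indeterminate has multiplicity \<open>m\<close>
  if exactly \<open>m\<close> factors of a factorization \<open>f x = (x - c\<^sub>1) \<cdots> (x - c\<^sub>n)\<close> are \<open>x - r\<close>.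
  Equality is equality of functions on the quaternions, so the indeterminate
  is not assumed to commute with the \<open>c\<^sub>l\<close>. Such a factorization
  need not be unique in general. For \<open>f x = x * x\<close> the only one is \<open>(x - 0) * (x - 0)\<close>.
\<close>

definition has_root_of_multiplicity :: "(quat \<Rightarrow> quat) \<Rightarrow> quat \<Rightarrow> nat \<Rightarrow> bool"
  where "has_root_of_multiplicity f r m \<longleftrightarrow>
    m > 0 \<and> (\<exists>cs. (\<forall>x. f x = (\<Prod>c\<leftarrow>cs. x - c)) \<and> count_list cs r = m)"

end

theory Submission
  imports Defs
begin

text \<open>
  Every quaternion is a root of its characteristic polynomial,
  \<open>x\<^sup>2 = 2 (Re x) x - |x|\<^sup>2\<close>, and everything follows from this identity.

  If \<open>x\<^sup>2 = y\<^sup>2\<close>, then \<open>|x| = |y|\<close> because the norm is multiplicative, so the identity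
  gives \<open>(Re x) x = (Re y) y\<close>. Comparing scalar parts, \<open>Re x = \<plusminus> Re y\<close>. If this number is
  not zero, it can be cancelled and \<open>x = \<plusminus> y\<close>. This is \<open>square_eq_square_imp_eq_or_eq_uminus\<close>,
  which limits the roots in case (1) to two.

  Applied to \<open>a\<close> instead of a root, the identity says \<open>(a + |a|)\<^sup>2 = 2 (|a| + Re a) a\<close>. So
  \<open>(a + |a|) / sqrt (2 (|a| + Re a))\<close> is a root with nonzero scalar part unless
  \<open>Re a = - |a|\<close>. Hence, if no such root exists, \<open>a\<close> is the real number \<open>- |a|\<close>, whose roots
  are the vectors of length \<open>sqrt |a|\<close>. For \<open>a \<noteq> 0\<close> these fill a sphere of positive
  radius, which is infinite.
\<close>

lemma norm_quat_power2:
  "(norm x)\<^sup>2 = (qRe x)\<^sup>2 + (qI x)\<^sup>2 + (qJ x)\<^sup>2 + (qK x)\<^sup>2"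
  by (simp add: norm_quat_def)

text \<open>The characteristic polynomial of \<open>x\<close>: its coefficients are the reduced trace \<open>2 Re x\<close>
  and the reduced norm \<open>|x|\<^sup>2\<close>.\<close>

lemma quat_square_eq:
  "x * x = (2 * qRe x) *\<^sub>R x - of_real ((norm x)\<^sup>2)"
  unfolding norm_quat_power2 by (simp add: quat_eq_iff power2_eq_square)

lemma uminus_in_square_roots:
  "x \<in> square_roots a \<Longrightarrow> - x \<in> square_roots a"
  by (simp add: square_roots_def)

lemma norm_square_root:
  assumes "x \<in> square_roots a"
  shows "(norm x)\<^sup>2 = norm a"
  using assms by (auto simp: square_roots_def norm_mult power2_eq_square)

text \<open>A scalar part that is not zero must be assumed: the units \<open>i\<close> and \<open>j\<close> have the
  same square.\<close>

lemma square_eq_square_imp_eq_or_eq_uminus: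
  fixes x y :: quat
  assumes sq: "x * x = y * y" and y: "qRe y \<noteq> 0"
  shows "x = y \<or> x = - y"
proof -
  have "(norm x)\<^sup>2 = (norm y)\<^sup>2"
    using arg_cong [OF sq, of norm] by (simp add: norm_mult power2_eq_square)
  then have eq: "qRe x *\<^sub>R x = qRe y *\<^sub>R y"
    using sq by (simp add: quat_square_eq flip: scaleR_scaleR)
  have "qRe x * qRe x = qRe y * qRe y"
    using arg_cong [OF eq, of qRe] by simp
  then consider "qRe x = qRe y" | "qRe x = - qRe y"
    by (auto simp: square_eq_iff)
  then show ?thesis
  proof cases
    case 1
    then show ?thesis using eq y by simp
  next
    case 2
    then have "qRe y *\<^sub>R (- x) = qRe y *\<^sub>R y" using eq by simp
    then have "- x = y" using y by (simp del: scaleR_minus_right)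
    then show ?thesis by auto
  qed
qed

lemma square_roots_eq_pair:
  assumes "y \<in> square_roots a" and "qRe y \<noteq> 0"
  shows "square_roots a = {y, - y}"
proof
  show "square_roots a \<subseteq> {y, - y}"
    using assms square_eq_square_imp_eq_or_eq_uminus by (auto simp: square_roots_def)
  show "{y, - y} \<subseteq> square_roots a"
    using assms uminus_in_square_roots by auto
qed

lemma qRe_add_norm_nonneg: "0 \<le> qRe a + norm a"
proof -
  have "(qRe a)\<^sup>2 \<le> (norm a)\<^sup>2"
    unfolding norm_quat_power2 by simp
  then have "\<bar>qRe a\<bar> \<le> norm a"
    by (rule abs_le_square_iff [THEN iffD2, of _ "norm a", simplified])
  then show ?thesis by linarith
qed

text \<open>The root is the quaternion form of the half-angle formula: as in the complex plane,
  \<open>a + |a|\<close> bisects the angle between \<open>a\<close> and the positive real axis, and only its length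
  has to be adjusted. It degenerates exactly on the nonpositive real axis.\<close>

lemma ex_square_root_qRe_nonzero:
  assumes "qRe a \<noteq> - norm a"
  shows "\<exists>x\<in>square_roots a. qRe x \<noteq> 0"
proof -
  define b where "b = a + of_real (norm a)"
  have pos: "qRe b > 0"
    using assms qRe_add_norm_nonneg [of a] by (simp add: b_def)
  define s where "s = sqrt (2 * qRe b)"
  have s: "s > 0" "s * s = 2 * qRe b"
    using pos by (simp_all add: s_def)
  have "b * b = a * a + (2 * norm a) *\<^sub>R a + of_real ((norm a)\<^sup>2)"
    by (simp add: b_def quat_eq_iff power2_eq_square algebra_simps)
  also have "\<dots> = (s * s) *\<^sub>R a"
    unfolding quat_square_eq [of a] s(2) by (simp add: b_def algebra_simps)
  finally have "(b /\<^sub>R s) * (b /\<^sub>R s) = a"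
    using s(1) by (simp add: field_simps)
  then have "b /\<^sub>R s \<in> square_roots a"
    by (simp add: square_roots_def)
  moreover have "qRe (b /\<^sub>R s) \<noteq> 0"
    using pos s(1) by simp
  ultimately show ?thesis by blast
qed

lemma quat_eq_of_real_uminus_norm:
  assumes "qRe a = - norm a"
  shows "a = of_real (- norm a)"
proof -
  have "(qI a)\<^sup>2 + (qJ a)\<^sup>2 + (qK a)\<^sup>2 = 0"
    using norm_quat_power2 [of a] assms by simp
  then have "qI a = 0 \<and> qJ a = 0 \<and> qK a = 0"
    by (smt (verit) zero_le_power2 zero_eq_power2)
  then show ?thesis
    using assms by (simp add: quat_eq_iff)
qed

text \<open>An arc of a great circle on the sphere of roots already has infinitely many points.\<close>

lemma infinite_square_roots_of_negative_real:
  fixes r :: real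
  assumes "r > 0"
  shows "infinite (square_roots (of_real (- r)))"
proof
  define arc where "arc t = Quat 0 t (sqrt (r - t\<^sup>2)) 0" for t
  assume "finite (square_roots (of_real (- r)))"
  moreover have "arc ` {0..sqrt r} \<subseteq> square_roots (of_real (- r))"
  proof (clarsimp simp: square_roots_def)
    fix t assume t: "0 \<le> t" "t \<le> sqrt r"
    then have "t\<^sup>2 \<le> r"
      using power_mono [of t "sqrt r" 2] assms by simp
    then show "arc t * arc t = - of_real r"
      by (simp add: arc_def quat_eq_iff power2_eq_square)
  qed
  moreover have "inj_on arc {0..sqrt r}"
    by (simp add: inj_on_def arc_def)
  ultimately have "finite {0..sqrt r}"
    by (metis finite_imageD finite_subset)
  then show False
    using assms by (simp add: infinite_Icc)
qed

theorem theorem5p5: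
  fixes a :: quat
  shows "((\<exists>x\<in>square_roots a. qRe x \<noteq> 0) \<longrightarrow>
           (\<exists>x1 x2. x1 \<noteq> x2 \<and> square_roots a = {x1, x2} \<and> x2 = - x1)) \<and>
         (a = 0 \<longrightarrow>
           0 \<in> square_roots a \<and> has_root_of_multiplicity (\<lambda>x. x * x - a) 0 2) \<and>
         (\<not> (\<exists>x\<in>square_roots a. qRe x \<noteq> 0) \<and> a \<noteq> 0 \<longrightarrow>
           a \<in> Re_H \<and> infinite (square_roots a) \<and>
           (\<forall>x\<in>square_roots a. x \<in> Im_H \<and> norm x = sqrt (- qRe a)))"
proof (intro conjI impI)
  assume "\<exists>x\<in>square_roots a. qRe x \<noteq> 0"
  then obtain y where y: "y \<in> square_roots a" "qRe y \<noteq> 0" by blast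
  then have "y \<noteq> - y"
    by (auto simp: quat_eq_iff)
  then show "\<exists>x1 x2. x1 \<noteq> x2 \<and> square_roots a = {x1, x2} \<and> x2 = - x1"
    using square_roots_eq_pair [OF y] by blast
next
  assume "a = 0"
  then show "0 \<in> square_roots a"
    by (simp add: square_roots_def)
  show "has_root_of_multiplicity (\<lambda>x. x * x - a) 0 2"
    unfolding has_root_of_multiplicity_def
    using \<open>a = 0\<close> by (intro conjI exI [of _ "[0, 0]"]) simp_all
next
  assume "\<not> (\<exists>x\<in>square_roots a. qRe x \<noteq> 0) \<and> a \<noteq> 0"
  then have vec: "\<And>x. x \<in> square_roots a \<Longrightarrow> qRe x = 0" and nz: "a \<noteq> 0"
    by auto
  then have re: "qRe a = - norm a"
    using ex_square_root_qRe_nonzero by blast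
  then have a: "a = of_real (- norm a)"
    by (rule quat_eq_of_real_uminus_norm)
  show "a \<in> Re_H"
    unfolding Re_H_def using a re by simp
  show "infinite (square_roots a)"
    using infinite_square_roots_of_negative_real [of "norm a"] nz a by simp
  show "\<forall>x\<in>square_roots a. x \<in> Im_H \<and> norm x = sqrt (- qRe a)"
  proof
    fix x assume x: "x \<in> square_roots a"
    have "norm x = sqrt (- qRe a)"
      using norm_square_root [OF x] re by (simp add: real_sqrt_unique)
    then show "x \<in> Im_H \<and> norm x = sqrt (- qRe a)"
      using vec [OF x] by (simp add: Im_H_def)
  qed
qed

end
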